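(* Let $f_1$ and $f_2$ be two probability densities of positive random variables, each satisfying Lin's condition on $(0,+\infty)$. Then there exists a random vector $(\xi_1,\xi_2)$ with absolutely continuous distribution (on $\mathbb{R}^2$) such that the coordinates $\xi_1$ and $\xi_2$ have densities $f_1$ and $f_2$ respectively, the density $g$ of the product $\xi_1\cdot\xi_2$ is continuously differentiable on $(0,+\infty)$, and $$\limsup_{x\to+\infty} L_g(x)=+\infty,\qquad \liminf_{x\to+\infty} L_g(x)=-\infty .$$
   Context: For a probability density $f$ of a positive random variable that is continuously differentiable on $(0,\infty)$, Lin's function of $f$ is $$L_f(x):=-\frac{x f'(x)}{f(x)},$$ defined at the points $x>0$ where $f(x)\neq 0$. Standing assumption: all densities considered are densities of positive random variables, are continuously differentiable on $(0,\infty)$, and do not vanish at any $x>0$, so that their Lin's functions are defined for all $x>0$. A density $f\in C^1(0,\infty)$ of a positive random variable satisfies Lin's condition on $(x_0,\infty)$ if $L_f$ is monotone increasing on $(x_0,\infty)$ and $\lim_{x\to+\infty}L_f(x)=+\infty$. "Monotone increasing" is understood in the strict sense. *)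

theory Defs
  imports "HOL-Probability.Probability"
begin

definition positive_rv_density :: "(real \<Rightarrow> real) \<Rightarrow> bool" where
  "positive_rv_density f \<longleftrightarrow>
     f \<in> borel_measurable borel \<and> (\<forall>x. 0 \<le> f x) \<and>
     prob_space (density lborel (\<lambda>x. ennreal (f x))) \<and>
     (AE x in density lborel (\<lambda>x. ennreal (f x)). 0 < x)"

text \<open>The standing assumption on densities, under which Lin's function is defined at
  every positive argument.\<close>

definition regular_density :: "(real \<Rightarrow> real) \<Rightarrow> bool" where
  "regular_density f \<longleftrightarrow>
     positive_rv_density f \<and> f C1_differentiable_on {0<..} \<and> (\<forall>x>0. f x \<noteq> 0)"

text \<open>Only meaningful at points \<open>x > 0\<close> where \<open>f\<close> is differentiable and \<open>f x \<noteq> 0\<close>.\<close>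

definition lin_function :: "(real \<Rightarrow> real) \<Rightarrow> real \<Rightarrow> real" where
  "lin_function f x = - (x * deriv f x / f x)"

definition lin_condition :: "real \<Rightarrow> (real \<Rightarrow> real) \<Rightarrow> bool" where
  "lin_condition x0 f \<longleftrightarrow>
     regular_density f \<and> strict_mono_on {x0<..} (lin_function f) \<and>
     filterlim (lin_function f) at_top at_top"

end

theory Submission
  imports Defs
begin

text \<open>In logarithmic coordinates \<open>\<xi>\<^sub>1 = exp s\<close>, \<open>\<xi>\<^sub>2 = exp t\<close> the product becomes the sum \<open>s + t\<close>. If the sum has
density \<open>Q\<close>, then the product has density \<open>g x = Q (ln x) / x\<close> and \<open>L\<^sub>g (exp w) = 1 - Q' w / Q w\<close>. So a coupling
of the two logarithms is wanted for which \<open>Q' / Q\<close> is unbounded above and below as \<open>w\<close> tends to infinity.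

Let \<open>A\<close> and \<open>B\<close> be the densities of the two logarithms. Lin's condition makes both unimodal
(\<open>tame_log_density\<close>), hence bounded with integrable derivative, and so their convolution, the density
of the sum in the independent case, is continuously differentiable (\<open>has_real_derivative_convolution\<close>).

The independent coupling is then perturbed on the disjoint squares \<open>[2n, 2n+1] \<times> [0, 1]\<close>: the term
\<open>\<plusminus> c\<^sub>n u\<^sub>n(s) v\<^sub>n(t)\<close> is added, where \<open>u\<^sub>n\<close> and \<open>v\<^sub>n\<close> oscillate with frequency \<open>k\<^sub>n\<close> and have integral zero, so
that the marginals do not change, and where \<open>c\<^sub>n\<close> is at most half the minimum of \<open>A s * B t\<close> on the square, so that
the density stays positive. At \<open>w = 2n + 1\<close> the phases of \<open>u\<^sub>n\<close> and \<open>v\<^sub>n\<close> are such that the perturbation of \<open>Q\<close>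
vanishes while that of \<open>Q'\<close> is \<open>\<plusminus> 3 pi c\<^sub>n k\<^sub>n / 8\<close> (\<open>wave_peak\<close>). The amplitude is tiny but the frequency is
free: for \<open>k\<^sub>n\<close> large enough this slope dominates both the slope and \<open>n\<close> times the value of the independent density
at \<open>2n + 1\<close>. Alternating signs then give \<open>Q' / Q \<ge> n\<close> for even \<open>n\<close> and \<open>Q' / Q \<le> - n\<close> for odd \<open>n\<close>
at these points.\<close>

section \<open>Differentiating a convolution\<close>

lemma integrable_bounded_mult:
  fixes u v :: "real \<Rightarrow> real"
  assumes "integrable M u" "v \<in> borel_measurable M" "\<And>x. \<bar>v x\<bar> \<le> K"
  shows "integrable M (\<lambda>x. u x * v x)"
proof (rule Bochner_Integration.integrable_bound)
  show "integrable M (\<lambda>x. K * u x)" using assms by simp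
  show "(\<lambda>x. u x * v x) \<in> borel_measurable M" using assms by measurable
  show "AE x in M. norm (u x * v x) \<le> norm (K * u x)"
  proof (rule AE_I2)
    fix x
    have "0 \<le> K" using assms(3)[of x] by linarith
    then show "norm (u x * v x) \<le> norm (K * u x)"
      using mult_left_mono[OF assms(3)[of x], of "\<bar>u x\<bar>"] by (simp add: abs_mult mult.commute)
  qed
qed

lemma convolution_commute:
  fixes u v :: "real \<Rightarrow> real"
  shows "(\<integral>s. u s * v (w - s) \<partial>lborel) = (\<integral>s. v s * u (w - s) \<partial>lborel)"
  by (subst lborel_integral_real_affine[where c = "-1" and t = w]) (auto simp: mult.commute)

text \<open>Translating the continuous factor \<open>v\<close> keeps the integrand below a multiple of \<open>\<bar>u\<bar>\<close>, so dominated
convergence applies.\<close>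

lemma continuous_on_convolution:
  fixes u v :: "real \<Rightarrow> real"
  assumes u: "integrable lborel u" and v: "continuous_on UNIV v" "\<And>x. \<bar>v x\<bar> \<le> K"
  shows "continuous_on UNIV (\<lambda>w. \<integral>s. u s * v (w - s) \<partial>lborel)"
  unfolding continuous_on_sequentially
proof (intro allI ballI impI, goal_cases)
  case (1 x a)
  have [measurable]: "v \<in> borel_measurable borel" using v(1) by (rule borel_measurable_continuous_onI)
  have [measurable]: "u \<in> borel_measurable borel" using u by simp
  have "(\<lambda>n. \<integral>s. u s * v (x n - s) \<partial>lborel) \<longlonglongrightarrow> (\<integral>s. u s * v (a - s) \<partial>lborel)"
  proof (rule integral_dominated_convergence[where w = "\<lambda>s. K * \<bar>u s\<bar>"])
    show "AE s in lborel. (\<lambda>n. u s * v (x n - s)) \<longlonglongrightarrow> u s * v (a - s)"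
    proof (intro AE_I2 tendsto_mult tendsto_const)
      fix s
      show "(\<lambda>n. v (x n - s)) \<longlonglongrightarrow> v (a - s)"
        using 1 v(1) by (intro continuous_on_tendsto_compose[where f = v and s = UNIV] tendsto_diff) auto
    qed
    show "integrable lborel (\<lambda>s. K * \<bar>u s\<bar>)" using u by simp
    show "AE s in lborel. norm (u s * v (x n - s)) \<le> K * \<bar>u s\<bar>" for n
    proof (rule AE_I2)
      fix s show "norm (u s * v (x n - s)) \<le> K * \<bar>u s\<bar>"
        using mult_right_mono[OF v(2)[of "x n - s"] abs_ge_zero[of "u s"]] by (simp add: abs_mult mult.commute)
    qed
  qed measurable
  then show ?case by (simp add: o_def)
qed

text \<open>The increment of \<open>u\<close> is the integral of \<open>u'\<close>, and Fubini moves that integral outside the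
convolution. Dominating the difference quotients of \<open>u\<close> instead can fail: the integrable function \<open>u'\<close>
may have arbitrarily high narrow peaks, so that its suprema over windows of fixed length need not be
integrable.\<close>

lemma convolution_diff_eq_integral:
  fixes u u' v :: "real \<Rightarrow> real"
  assumes u: "integrable lborel u" "\<And>x. (u has_real_derivative u' x) (at x)"
    and u': "continuous_on UNIV u'" "integrable lborel u'"
    and v: "continuous_on UNIV v" "integrable lborel v" "\<And>x. \<bar>v x\<bar> \<le> K"
    and "a \<le> b"
  shows "(\<integral>s. u s * v (b - s) \<partial>lborel) - (\<integral>s. u s * v (a - s) \<partial>lborel)
         = integral {a..b} (\<lambda>w. \<integral>s. u' s * v (w - s) \<partial>lborel)"
proof -
  have [measurable]: "v \<in> borel_measurable borel" "u' \<in> borel_measurable borel" "u \<in> borel_measurable borel"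
    using v(1) u'(1) u(1) by (auto intro: borel_measurable_continuous_onI)
  define D where "D = (\<lambda>w. \<integral>s. u' s * v (w - s) \<partial>lborel)"
  have D: "continuous_on UNIV D"
    unfolding D_def by (rule continuous_on_convolution[OF u'(2) v(1,3)])
  define f where "f = (\<lambda>s x. v s * (indicator {a..b} x * u' (x - s)))"
  have shift: "integrable lborel (\<lambda>x. u' (x - s))" for s
    using lborel_integrable_real_affine[OF u'(2), of 1 "-s"] by simp
  have ind: "integrable lborel (\<lambda>x. indicator {a..b} x * u' (x - s))" for s
    using integrable_real_mult_indicator[of "{a..b}" lborel, OF _ shift[of s]]
    by (simp add: mult.commute)
  have "integrable (lborel \<Otimes>\<^sub>M lborel) (case_prod f)"
  proof (rule lborel_pair.Fubini_integrable)
    show "case_prod f \<in> borel_measurable (lborel \<Otimes>\<^sub>M lborel)" unfolding f_def by measurable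
    show "AE s in lborel. integrable lborel (\<lambda>x. case (s, x) of (x, xa) \<Rightarrow> f x xa)"
      unfolding f_def using ind by auto
    have eq: "(\<lambda>s. \<integral>x. norm (case (s, x) of (x, xa) \<Rightarrow> f x xa) \<partial>lborel)
       = (\<lambda>s. \<bar>v s\<bar> * (\<integral>x. \<bar>indicator {a..b} x * u' (x - s)\<bar> \<partial>lborel))"
      unfolding f_def by (simp add: abs_mult)
    show "integrable lborel (\<lambda>s. \<integral>x. norm (case (s, x) of (x, xa) \<Rightarrow> f x xa) \<partial>lborel)"
      unfolding eq
    proof (rule integrable_bounded_mult[where K = "\<integral>x. \<bar>u' x\<bar> \<partial>lborel"])
      show "integrable lborel (\<lambda>s. \<bar>v s\<bar>)" using v by simp
      show "(\<lambda>s. \<integral>x. \<bar>indicator {a..b} x * u' (x - s)\<bar> \<partial>lborel) \<in> borel_measurable lborel"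
        by measurable
      fix s
      have "(\<integral>x. \<bar>indicator {a..b} x * u' (x - s)\<bar> \<partial>lborel) \<le> (\<integral>x. \<bar>u' (x - s)\<bar> \<partial>lborel)"
        by (intro integral_mono integrable_abs ind shift) (auto simp: indicator_def)
      also have "\<dots> = (\<integral>x. \<bar>u' x\<bar> \<partial>lborel)"
        by (subst lborel_integral_real_affine[where c = 1 and t = "-s" and f = "\<lambda>x. \<bar>u' x\<bar>"]) auto
      finally show "\<bar>\<integral>x. \<bar>indicator {a..b} x * u' (x - s)\<bar> \<partial>lborel\<bar> \<le> (\<integral>x. \<bar>u' x\<bar> \<partial>lborel)"
        by simp
    qed
  qed
  from lborel_pair.Fubini_integral[OF this]
  have "(\<integral>x. (\<integral>s. f s x \<partial>lborel) \<partial>lborel) = (\<integral>s. (\<integral>x. f s x \<partial>lborel) \<partial>lborel)" .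
  also have "(\<lambda>s. \<integral>x. f s x \<partial>lborel) = (\<lambda>s. v s * u (b - s) - v s * u (a - s))"
  proof
    fix s
    have "(\<integral>x. u' (x - s) * indicator {a..b} x \<partial>lborel) = u (b - s) - u (a - s)"
    proof (rule integral_FTC_Icc_real[OF \<open>a \<le> b\<close>])
      show "((\<lambda>x. u (x - s)) has_real_derivative u' (x - s)) (at x)" for x
        using DERIV_shift[of u "u' (x-s)" x "-s"] u(2)[of "x - s"] by simp
      show "isCont (\<lambda>x. u' (x - s)) x" for x
        using continuous_on_compose2[OF u'(1), of UNIV "\<lambda>x. x - s"]
        by (auto simp: continuous_on_eq_continuous_at intro: continuous_intros)
    qed
    then show "(\<integral>x. f s x \<partial>lborel) = v s * u (b - s) - v s * u (a - s)"
      unfolding f_def by (simp add: mult.commute right_diff_distrib[symmetric])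
  qed
  also have "(\<lambda>x. \<integral>s. f s x \<partial>lborel) = (\<lambda>x. indicator {a..b} x *\<^sub>R D x)"
  proof
    fix x
    have "(\<integral>s. f s x \<partial>lborel) = (\<integral>s. indicator {a..b} x * (v s * u' (x - s)) \<partial>lborel)"
      unfolding f_def by (simp add: mult_ac)
    also have "\<dots> = indicator {a..b} x * D x"
      unfolding D_def by (simp add: convolution_commute[of u' v])
    finally show "(\<integral>s. f s x \<partial>lborel) = indicator {a..b} x *\<^sub>R D x" by simp
  qed
  also have "(\<integral>x. indicator {a..b} x *\<^sub>R D x \<partial>lborel) = integral {a..b} D"
    using set_borel_integral_eq_integral(2)[OF borel_integrable_atLeastAtMost'[OF continuous_on_subset[OF D]], of a b]
    by (simp add: set_lebesgue_integral_def)
  also have "(\<integral>s. v s * u (b - s) - v s * u (a - s) \<partial>lborel)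
      = (\<integral>s. v s * u (b - s) \<partial>lborel) - (\<integral>s. v s * u (a - s) \<partial>lborel)"
  proof (rule Bochner_Integration.integral_diff)
    have "integrable lborel (\<lambda>s. u (w - s) * v s)" for w
      using lborel_integrable_real_affine[OF u(1), of "-1" w] v(3)
      by (intro integrable_bounded_mult[where K = K]) auto
    then show "integrable lborel (\<lambda>s. v s * u (b - s))" "integrable lborel (\<lambda>s. v s * u (a - s))"
      by (simp_all add: mult.commute)
  qed
  finally show ?thesis unfolding D_def by (simp add: convolution_commute[of u v])
qed

lemma has_real_derivative_convolution:
  fixes u u' v :: "real \<Rightarrow> real"
  assumes u: "integrable lborel u" "\<And>x. (u has_real_derivative u' x) (at x)"
    and u': "continuous_on UNIV u'" "integrable lborel u'"
    and v: "continuous_on UNIV v" "integrable lborel v" "\<And>x. \<bar>v x\<bar> \<le> K"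
  shows "((\<lambda>w. \<integral>s. u s * v (w - s) \<partial>lborel) has_real_derivative
          (\<integral>s. u' s * v (w - s) \<partial>lborel)) (at w)"
proof -
  let ?C = "\<lambda>w. \<integral>s. u s * v (w - s) \<partial>lborel" and ?D = "\<lambda>w. \<integral>s. u' s * v (w - s) \<partial>lborel"
  have "continuous_on UNIV ?D" by (rule continuous_on_convolution[OF u'(2) v(1,3)])
  then have "((\<lambda>x. integral {w - 1..x} ?D) has_real_derivative ?D w) (at w within {w - 1..w + 1})"
    by (intro integral_has_real_derivative) (auto intro: continuous_on_subset)
  then have "((\<lambda>x. integral {w - 1..x} ?D) has_real_derivative ?D w) (at w)"
    by (simp add: at_within_Icc_at)
  then have *: "((\<lambda>x. ?C (w - 1) + integral {w - 1..x} ?D) has_real_derivative ?D w) (at w)"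
    by (auto intro!: derivative_eq_intros)
  show ?thesis
  proof (rule DERIV_cong_ev[THEN iffD1, OF refl _ refl *])
    have "\<forall>\<^sub>F x in nhds w. w - 1 < x" using order_tendstoD(1)[OF filterlim_ident, of "w - 1" w] by simp
    then show "\<forall>\<^sub>F x in nhds w. ?C (w - 1) + integral {w - 1..x} ?D = ?C x"
    proof eventually_elim
      case (elim x)
      show ?case
        using convolution_diff_eq_integral[OF u u' v, of "w - 1" x] elim by simp
    qed
  qed
qed

section \<open>Lin densities in logarithmic coordinates\<close>

lemma has_bochner_integral_lborel_iff:
  fixes f :: "real \<Rightarrow> real"
  assumes [measurable]: "f \<in> borel_measurable borel" "S \<in> sets borel"
  shows "has_bochner_integral lborel (\<lambda>x. indicator S x * f x) b
     \<longleftrightarrow> f absolutely_integrable_on S \<and> integral S f = b"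
proof -
  have "f absolutely_integrable_on S \<longleftrightarrow> integrable lborel (\<lambda>x. indicator S x * f x)"
    unfolding set_integrable_def by (subst integrable_completion) simp_all
  moreover have "integral S f = (\<integral>x. indicator S x * f x \<partial>lborel)"
    if *: "f absolutely_integrable_on S"
    using set_lebesgue_integral_eq_integral(2)[OF *]
    unfolding set_lebesgue_integral_def by (simp add: integral_completion)
  ultimately show ?thesis
    by (auto simp: has_bochner_integral_iff)
qed

lemma has_bochner_integral_exp_iff:
  fixes F :: "real \<Rightarrow> real"
  assumes [measurable]: "F \<in> borel_measurable borel"
  shows "has_bochner_integral lborel (\<lambda>s. exp s * F (exp s)) b
     \<longleftrightarrow> has_bochner_integral lborel (\<lambda>x. indicator {0<..} x * F x) b"
proof -
  have r: "range (exp :: real \<Rightarrow> real) = {0<..}"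
    by (auto simp: image_def) (metis exp_ln)
  have d: "(exp has_field_derivative exp x) (at x within UNIV)" for x :: real
    by (auto intro!: derivative_eq_intros)
  have "(\<lambda>x. \<bar>exp x\<bar> * F (exp x)) absolutely_integrable_on UNIV \<and>
        integral UNIV (\<lambda>x. \<bar>exp x\<bar> * F (exp x)) = b
     \<longleftrightarrow> F absolutely_integrable_on {0<..} \<and> integral {0<..} F = b"
    using has_absolute_integral_change_of_variables_1'[of UNIV exp exp F b] d
    by (simp add: r inj_on_def)
  then show ?thesis
    using has_bochner_integral_lborel_iff[of "\<lambda>x. exp x * F (exp x)" UNIV b]
      has_bochner_integral_lborel_iff[of F "{0<..}" b] by simp
qed

lemma unimodal_le_mode:
  fixes A A' :: "real \<Rightarrow> real"
  assumes A: "\<And>x. (A has_real_derivative A' x) (at x)"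
    and up: "\<And>x. x \<le> m \<Longrightarrow> 0 \<le> A' x" and down: "\<And>x. m \<le> x \<Longrightarrow> A' x \<le> 0"
  shows "A x \<le> A m"
proof (cases "x \<le> m")
  case True
  then show ?thesis using A up by (intro DERIV_nonneg_imp_nondecreasing[of x m A]) auto
next
  case False
  then show ?thesis using A down by (intro DERIV_nonpos_imp_nonincreasing[of m x A]) auto
qed

text \<open>The total variation of a unimodal function is at most twice its maximum, and this total variation is the
integral of \<open>\<bar>A'\<bar>\<close>.\<close>

lemma unimodal_integrable_deriv:
  fixes A A' :: "real \<Rightarrow> real"
  assumes A: "\<And>x. (A has_real_derivative A' x) (at x)" "\<And>x. 0 \<le> A x"
    and A': "continuous_on UNIV A'"
    and up: "\<And>x. x \<le> m \<Longrightarrow> 0 \<le> A' x" and down: "\<And>x. m \<le> x \<Longrightarrow> A' x \<le> 0"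
  shows "integrable lborel A'"
proof (rule integrableI_bounded)
  have [measurable]: "A' \<in> borel_measurable borel" using A' by (rule borel_measurable_continuous_onI)
  then show "A' \<in> borel_measurable lborel" by simp
  define f where "f = (\<lambda>(i::nat) x. ennreal \<bar>A' x\<bar> * indicator {m - real i..m + real i} x)"
  have bound: "(\<integral>\<^sup>+x. f i x \<partial>lborel) \<le> ennreal (A m) + ennreal (A m)" for i
  proof -
    have "(\<integral>\<^sup>+x. f i x \<partial>lborel) \<le> (\<integral>\<^sup>+x. ennreal (A' x) * indicator {m - real i..m} x
        + ennreal (- A' x) * indicator {m..m + real i} x \<partial>lborel)"
      unfolding f_def
    proof (rule nn_integral_mono)
      fix x
      show "ennreal \<bar>A' x\<bar> * indicator {m - real i..m + real i} x
          \<le> ennreal (A' x) * indicator {m - real i..m} x + ennreal (- A' x) * indicator {m..m + real i} x"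
        using up[of x] down[of x] by (auto simp: indicator_def abs_if ennreal_neg)
    qed
    also have "\<dots> = (\<integral>\<^sup>+x. ennreal (A' x) * indicator {m - real i..m} x \<partial>lborel)
        + (\<integral>\<^sup>+x. ennreal (- A' x) * indicator {m..m + real i} x \<partial>lborel)"
      by (intro nn_integral_add) auto
    also have "(\<integral>\<^sup>+x. ennreal (A' x) * indicator {m - real i..m} x \<partial>lborel) = ennreal (A m - A (m - real i))"
      by (rule nn_integral_FTC_Icc) (auto intro: A up)
    also have "(\<integral>\<^sup>+x. ennreal (- A' x) * indicator {m..m + real i} x \<partial>lborel)
        = ennreal (- A (m + real i) - - A m)"
      by (rule nn_integral_FTC_Icc) (auto intro!: derivative_eq_intros A simp: down)
    also have "ennreal (A m - A (m - real i)) + ennreal (- A (m + real i) - - A m)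
        \<le> ennreal (A m) + ennreal (A m)"
      using A(2) by (intro add_mono ennreal_leI) auto
    finally show ?thesis .
  qed
  have sup: "(SUP i. f i x) = ennreal \<bar>A' x\<bar>" for x
  proof (rule antisym)
    show "(SUP i. f i x) \<le> ennreal \<bar>A' x\<bar>"
      by (rule SUP_least) (auto simp: f_def indicator_def)
    obtain i :: nat where "\<bar>x - m\<bar> \<le> real i" using real_arch_simple by blast
    then have "f i x = ennreal \<bar>A' x\<bar>" by (auto simp: f_def indicator_def)
    then show "ennreal \<bar>A' x\<bar> \<le> (SUP i. f i x)" by (metis SUP_upper UNIV_I)
  qed
  have "(\<integral>\<^sup>+x. ennreal (norm (A' x)) \<partial>lborel) = (\<integral>\<^sup>+x. (SUP i. f i x) \<partial>lborel)"
    by (simp add: sup)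
  also have "\<dots> = (SUP i. \<integral>\<^sup>+x. f i x \<partial>lborel)"
  proof (rule nn_integral_monotone_convergence_SUP)
    show "incseq f"
      by (auto simp: incseq_def le_fun_def f_def indicator_def)
    show "f i \<in> borel_measurable lborel" for i unfolding f_def by measurable
  qed
  also have "\<dots> \<le> ennreal (A m) + ennreal (A m)" by (rule SUP_least) (rule bound)
  also have "\<dots> < \<infinity>" by simp
  finally show "(\<integral>\<^sup>+x. ennreal (norm (A' x)) \<partial>lborel) < \<infinity>" .
qed

text \<open>A positive function that decreases on the whole line is at least \<open>A 0\<close> on the negative half-line.
This forces Lin's function to lie at or below \<open>1\<close> somewhere.\<close>

lemma positive_decreasing_not_integrable:
  fixes A A' :: "real \<Rightarrow> real"
  assumes A: "\<And>x. (A has_real_derivative A' x) (at x)" "\<And>x. 0 < A x" and int: "integrable lborel A"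
  shows "\<exists>x. 0 \<le> A' x"
proof (rule ccontr)
  assume "\<nexists>x. 0 \<le> A' x"
  then have neg: "A' x \<le> 0" for x by (meson le_cases)
  have le: "A 0 \<le> A x" if "x \<le> 0" for x
    using A(1) neg that by (intro DERIV_nonpos_imp_nonincreasing[of x 0 A]) auto
  have bnd: "A 0 * real n \<le> (\<integral>x. A x \<partial>lborel)" for n :: nat
  proof -
    have "A 0 * real n = (\<integral>x. A 0 * indicator {- real n..0} x \<partial>lborel)" by simp
    also have "\<dots> \<le> (\<integral>x. A x \<partial>lborel)"
    proof (rule integral_mono[OF _ int])
      show "integrable lborel (\<lambda>x. A 0 * indicator {- real n..0} x)" by simp
      fix x show "A 0 * indicator {- real n..0} x \<le> A x"
        using le[of x] A(2)[of x] by (auto simp: indicator_def)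
    qed
    finally show ?thesis .
  qed
  obtain n :: nat where "(\<integral>x. A x \<partial>lborel) / A 0 < real n" using reals_Archimedean2 by blast
  then show False using bnd[of n] A(2)[of 0] by (simp add: field_simps)
qed

text \<open>The properties of the density of \<open>ln \<xi>\<close> on which the construction relies; \<open>A'\<close> is the derivative.\<close>

definition tame_density :: "(real \<Rightarrow> real) \<Rightarrow> (real \<Rightarrow> real) \<Rightarrow> bool" where
  "tame_density A A' \<longleftrightarrow> (\<forall>x. 0 < A x) \<and> (\<forall>x. (A has_real_derivative A' x) (at x)) \<and>
     continuous_on UNIV A' \<and> has_bochner_integral lborel A 1 \<and> integrable lborel A' \<and>
     (\<exists>K. \<forall>x. A x \<le> K)"

lemma positive_rv_density_AE:
  assumes "positive_rv_density f"
  shows "AE x in lborel. x \<le> 0 \<longrightarrow> f x = 0"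
proof -
  have [measurable]: "f \<in> borel_measurable borel" and nonneg: "\<And>x. 0 \<le> f x"
    and "AE x in density lborel (\<lambda>x. ennreal (f x)). 0 < x"
    using assms unfolding positive_rv_density_def by auto
  then have "AE x in lborel. 0 < ennreal (f x) \<longrightarrow> 0 < x"
    by (subst (asm) AE_density) auto
  then show ?thesis
  proof eventually_elim
    case (elim x) then show ?case using nonneg[of x] by (auto simp: less_le)
  qed
qed

text \<open>If \<open>\<xi>\<close> has density \<open>f\<close>, then \<open>ln \<xi>\<close> has density \<open>A s = exp s * f (exp s)\<close>, whose logarithmic
derivative is \<open>1 - L\<^sub>f (exp s)\<close>. Lin's condition makes this quantity decrease from nonnegative to negative
values, so \<open>A\<close> is unimodal: it is bounded by its value at the mode and has an integrable derivative.\<close>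

lemma tame_log_density:
  assumes "lin_condition 0 f"
  shows "tame_density (\<lambda>s. exp s * f (exp s)) (\<lambda>s. exp s * f (exp s) + exp s * (exp s * deriv f (exp s)))"
    (is "tame_density ?A ?A'")
proof -
  have reg: "regular_density f" and mono: "strict_mono_on {0<..} (lin_function f)"
    and lim: "filterlim (lin_function f) at_top at_top"
    using assms unfolding lin_condition_def by auto
  have pd: "positive_rv_density f" and C1: "f C1_differentiable_on {0<..}" and nz: "\<And>x. x > 0 \<Longrightarrow> f x \<noteq> 0"
    using reg unfolding regular_density_def by auto
  have [measurable]: "f \<in> borel_measurable borel" and nonneg: "\<And>x. 0 \<le> f x"
    and prob: "prob_space (density lborel (\<lambda>x. ennreal (f x)))"
    using pd unfolding positive_rv_density_def by auto
  have pos: "0 < f x" if "0 < x" for x using nz[OF that] nonneg[of x] by linarith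
  from C1 have diff: "\<And>x. 0 < x \<Longrightarrow> f differentiable at x"
    and cont: "continuous_on {0<..} (\<lambda>x. vector_derivative f (at x))"
    unfolding C1_differentiable_on_eq by auto
  have der: "(f has_real_derivative deriv f x) (at x)" if "0 < x" for x
    using diff[OF that] DERIV_deriv_iff_real_differentiable by blast
  have "continuous_on {0<..} (deriv f)"
    using cont der by (elim continuous_on_eq)
      (auto simp: has_real_derivative_iff_has_vector_derivative vector_derivative_at)
  moreover have contf: "continuous_on {0<..} f"
    by (intro continuous_at_imp_continuous_on ballI) (auto intro: DERIV_isCont der)
  ultimately have cont': "continuous_on UNIV (\<lambda>s. f (exp s))" "continuous_on UNIV (\<lambda>s. deriv f (exp s))"
    by (auto intro!: continuous_on_compose2[where f = exp] continuous_intros)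
  have dA: "(?A has_real_derivative ?A' s) (at s)" for s
    by (auto intro!: derivative_eq_intros DERIV_chain2[OF der])
  have cA': "continuous_on UNIV ?A'"
    by (intro continuous_intros cont')
  have posA: "0 < ?A s" for s by (simp add: pos)
  have A'_eq: "?A' s = ?A s * (1 - lin_function f (exp s))" for s
    using pos[of "exp s"] by (simp add: lin_function_def field_simps)
  have "(\<integral>\<^sup>+x. ennreal (f x) \<partial>lborel) = 1"
    using prob_space.emeasure_space_1[OF prob] by (simp add: emeasure_density)
  then have "has_bochner_integral lborel f 1"
    using nonneg by (intro has_bochner_integral_nn_integral) auto
  moreover have "AE x in lborel. f x = indicator {0<..} x * f x"
    using positive_rv_density_AE[OF pd] by eventually_elim (auto simp: indicator_def)
  ultimately have "has_bochner_integral lborel (\<lambda>x. indicator {0<..} x * f x) 1"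
    by (subst (asm) has_bochner_integral_cong_AE) auto
  then have hA: "has_bochner_integral lborel ?A 1"
    by (subst has_bochner_integral_exp_iff) auto
  obtain m where m: "?A' m = 0"
  proof -
    obtain s where s: "0 \<le> ?A' s"
      using positive_decreasing_not_integrable[OF dA posA] hA has_bochner_integral_iff by blast
    have "\<forall>\<^sub>F x in at_top. 1 < lin_function f x" using lim by (simp add: filterlim_at_top_dense)
    then obtain N where N: "\<And>x. x \<ge> N \<Longrightarrow> 1 < lin_function f x"
      by (auto simp: eventually_at_top_linorder)
    define t where "t = max s (ln (max N 1))"
    have "N \<le> exp (ln (max N 1))" by (subst exp_ln) auto
    also have "\<dots> \<le> exp t" by (simp only: exp_le_cancel_iff t_def max.cobounded2)
    finally have "exp t \<ge> N" .
    then have t: "?A' t \<le> 0" unfolding A'_eq using N[of "exp t"] posA[of t]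
      by (intro mult_nonneg_nonpos) (auto simp: nonneg)
    have "\<exists>x\<ge>s. x \<le> t \<and> ?A' x = 0"
      using s t continuous_on_subset[OF cA'] by (intro IVT2') (auto simp: t_def)
    then show ?thesis using that by blast
  qed
  have L1: "lin_function f (exp m) = 1" using m posA[of m] unfolding A'_eq by auto
  have Lmono: "lin_function f (exp x) \<le> lin_function f (exp y)" if "x \<le> y" for x y
    using strict_mono_on_leD[OF mono] that by simp
  have up: "0 \<le> ?A' x" if "x \<le> m" for x
    unfolding A'_eq using Lmono[OF that] L1 posA[of x] by (intro mult_nonneg_nonneg) (auto simp: nonneg)
  have down: "?A' x \<le> 0" if "m \<le> x" for x
    unfolding A'_eq using Lmono[OF that] L1 posA[of x] by (intro mult_nonneg_nonpos) (auto simp: nonneg)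
  have "integrable lborel ?A'"
    by (rule unimodal_integrable_deriv[OF dA less_imp_le[OF posA] cA' up down])
  moreover have "?A x \<le> ?A m" for x by (rule unimodal_le_mode[OF dA up down])
  ultimately show ?thesis
    unfolding tame_density_def using posA dA cA' hA by blast
qed

section \<open>One oscillating block\<close>

text \<open>The two profiles of a block: the derivative of \<open>bump k\<close> is \<open>6 * pi * k * ripple k\<close>. Both have
integral zero, which preserves the marginals, and the powers of the sine vanish to high enough order at
\<open>0\<close> and \<open>1\<close> that cutting off outside the unit interval leaves \<open>bump k\<close> continuously differentiable and
\<open>ripple k\<close> continuous. Because \<open>ripple k\<close> is symmetric about \<open>1 / 2\<close>, convolving it with the derivative of
\<open>bump k\<close> gives, at argument \<open>1\<close>, the integral of a square: a slope proportional to the frequency \<open>k\<close>, while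
the convolution itself vanishes there.\<close>

definition bump :: "nat \<Rightarrow> real \<Rightarrow> real" where
  "bump k s = indicator {0..1} s * sin (2 * pi * k * s) ^ 3"

definition ripple :: "nat \<Rightarrow> real \<Rightarrow> real" where
  "ripple k s = indicator {0..1} s * (sin (2 * pi * k * s) ^ 2 * cos (2 * pi * k * s))"

lemma sin_cos_period:
  "sin (2 * pi * real k) = 0" "cos (2 * pi * real k) = 1"
  using sin_npi[of "2 * k"] cos_npi[of "2 * k"] by (simp_all add: mult_ac)

text \<open>The cut-off only shrinks the difference quotients at a double zero.\<close>

lemma has_real_derivative_indicator_vanishing:
  fixes F :: "real \<Rightarrow> real"
  assumes "(F has_real_derivative 0) (at x)" "F x = 0"
  shows "((\<lambda>y. indicator S y * F y) has_real_derivative 0) (at x)"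
  unfolding has_field_derivative_iff
proof (rule tendsto_0_le)
  show "((\<lambda>y. (F y - F x) / (y - x)) \<longlongrightarrow> 0) (at x)"
    using assms(1) unfolding has_field_derivative_iff .
  show "\<forall>\<^sub>F y in at x. norm ((indicator S y * F y - indicator S x * F x) / (y - x))
      \<le> norm ((F y - F x) / (y - x)) * 1"
    using assms(2) by (intro always_eventually allI) (auto simp: indicator_def)
qed

lemma has_real_derivative_bump:
  "(bump k has_real_derivative 6 * pi * k * ripple k s) (at s)"
proof -
  let ?F = "\<lambda>s. sin (2 * pi * k * s) ^ 3"
  let ?F' = "\<lambda>s. 6 * pi * k * (sin (2 * pi * k * s) ^ 2 * cos (2 * pi * k * s))"
  have F: "(?F has_real_derivative ?F' s) (at s)" for s
    by (auto intro!: derivative_eq_intros simp: numeral_3_eq_3 power2_eq_square)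
  have bump: "bump k = (\<lambda>s. indicator {0..1} s * ?F s)" by (simp add: bump_def fun_eq_iff)
  consider "s = 0 \<or> s = 1" | "s < 0 \<or> s > 1" | "0 < s" "s < 1" by linarith
  then show ?thesis
  proof cases
    case 1
    then have "?F s = 0" "?F' s = 0" using sin_cos_period by auto
    moreover from this have "ripple k s = 0" by (auto simp: ripple_def)
    ultimately show ?thesis
      unfolding bump using has_real_derivative_indicator_vanishing[where F = ?F and x = s] F[of s] by simp
  next
    case 2
    then have "s \<in> - {0..1}" "open (- {0..1::real})" by auto
    then have ev: "\<forall>\<^sub>F y in nhds s. y \<in> - {0..1}" by (intro eventually_nhds_in_open)
    have "\<forall>\<^sub>F y in nhds s. bump k y = 0"
      using ev by eventually_elim (auto simp: bump_def)
    from DERIV_cong_ev[OF refl this refl] have "(bump k has_real_derivative 0) (at s)" by simp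
    then show ?thesis using 2 by (auto simp: ripple_def)
  next
    case 3
    then have ev: "\<forall>\<^sub>F y in nhds s. y \<in> {0<..<1}" by (intro eventually_nhds_in_open) auto
    have "\<forall>\<^sub>F y in nhds s. bump k y = ?F y"
      using ev by eventually_elim (auto simp: bump_def)
    from DERIV_cong_ev[OF refl this refl] have "(bump k has_real_derivative ?F' s) (at s)"
      using F[of s] by simp
    then show ?thesis using 3 by (auto simp: ripple_def)
  qed
qed

lemma continuous_on_ripple: "continuous_on UNIV (ripple k)"
proof -
  let ?G = "\<lambda>s. sin (2 * pi * k * s) ^ 2 * cos (2 * pi * k * s)"
  \<comment> \<open>Clamping the argument to the unit interval is the same as cutting off, since \<open>?G\<close> vanishes at both ends.\<close>
  have "ripple k = (\<lambda>s. ?G (max 0 (min 1 s)))"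
    by (auto simp: ripple_def fun_eq_iff indicator_def max_def min_def sin_cos_period)
  moreover have "continuous_on UNIV (\<lambda>s. ?G (max 0 (min 1 s)))"
    by (intro continuous_intros)
  ultimately show ?thesis by simp
qed

lemma continuous_on_bump: "continuous_on UNIV (bump k)"
  by (meson DERIV_continuous_on has_field_derivative_at_within has_real_derivative_bump)

lemma abs_bump_le: "\<bar>bump k s\<bar> \<le> 1"
proof -
  have "\<bar>sin (2 * pi * k * s)\<bar> ^ 3 \<le> 1" by (rule power_le_one) auto
  then show ?thesis by (simp add: bump_def indicator_def power_abs)
qed

lemma abs_ripple_le: "\<bar>ripple k s\<bar> \<le> 1"
proof -
  have "\<bar>sin (2 * pi * k * s)\<bar> ^ 2 * \<bar>cos (2 * pi * k * s)\<bar> \<le> 1"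
    by (intro mult_le_one power_le_one) auto
  then show ?thesis by (simp add: ripple_def indicator_def abs_mult)
qed

lemma has_bochner_integral_unit_interval:
  fixes F f :: "real \<Rightarrow> real"
  assumes "\<And>x. (F has_real_derivative f x) (at x)" "continuous_on UNIV f"
  shows "has_bochner_integral lborel (\<lambda>x. indicator {0..1} x * f x) (F 1 - F 0)"
  using has_bochner_integral_FTC_Icc_real[of 0 1 F f] assms
  by (simp add: continuous_on_eq_continuous_at mult.commute)

lemma has_bochner_integral_ripple: "has_bochner_integral lborel (ripple k) 0"
proof (cases "k = 0")
  case True
  then have "ripple k = (\<lambda>s. 0)" by (auto simp: ripple_def)
  then show ?thesis using has_bochner_integral_zero by simp
next
  case False
  have "has_bochner_integral lborel (\<lambda>s. indicator {0..1} s * (sin (2 * pi * k * s) ^ 2 * cos (2 * pi * k * s)))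
     (sin (2 * pi * k * 1) ^ 3 / (6 * pi * k) - sin (2 * pi * k * 0) ^ 3 / (6 * pi * k))"
    using False by (intro has_bochner_integral_unit_interval continuous_intros)
      (auto intro!: derivative_eq_intros simp: field_simps power2_eq_square numeral_3_eq_3)
  then show ?thesis by (simp add: ripple_def[abs_def] sin_cos_period)
qed

lemma has_bochner_integral_bump: "has_bochner_integral lborel (bump k) 0"
proof (cases "k = 0")
  case True
  then have "bump k = (\<lambda>s. 0)" by (auto simp: bump_def)
  then show ?thesis using has_bochner_integral_zero by simp
next
  case False
  let ?F = "\<lambda>s. (cos (2 * pi * k * s) ^ 3 / 3 - cos (2 * pi * k * s)) / (2 * pi * k)"
  have d: "(?F has_real_derivative sin (2 * pi * k * s) ^ 3) (at s)" for s
  proof -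
    have "(?F has_real_derivative sin (2 * pi * k * s) * (1 - cos (2 * pi * k * s) ^ 2)) (at s)"
      using False by (auto intro!: derivative_eq_intros simp: field_simps power2_eq_square)
    moreover have "sin (2 * pi * k * s) * (1 - cos (2 * pi * k * s) ^ 2) = sin (2 * pi * k * s) ^ 3"
      unfolding cos_squared_eq by (simp add: power_numeral_reduce)
    ultimately show ?thesis by simp
  qed
  have "has_bochner_integral lborel (\<lambda>s. indicator {0..1} s * sin (2 * pi * k * s) ^ 3) (?F 1 - ?F 0)"
    by (intro has_bochner_integral_unit_interval continuous_intros d)
  then show ?thesis by (simp add: bump_def[abs_def] sin_cos_period)
qed

lemma ripple_reflect: "ripple k (1 - s) = ripple k s"
proof -
  have "sin (2 * pi * k * (1 - s)) = - sin (2 * pi * k * s)"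
    "cos (2 * pi * k * (1 - s)) = cos (2 * pi * k * s)"
    using sin_diff[of "2 * pi * k" "2 * pi * k * s"] cos_diff[of "2 * pi * k" "2 * pi * k * s"]
    by (simp_all add: right_diff_distrib sin_cos_period)
  then show ?thesis by (auto simp: ripple_def indicator_def)
qed

lemma integral_bump_ripple: "(\<integral>s. bump k s * ripple k s \<partial>lborel) = 0"
proof (cases "k = 0")
  case False
  have "has_bochner_integral lborel (\<lambda>s. indicator {0..1} s * (sin (2 * pi * k * s) ^ 5 * cos (2 * pi * k * s)))
     (sin (2 * pi * k * 1) ^ 6 / (12 * pi * k) - sin (2 * pi * k * 0) ^ 6 / (12 * pi * k))"
    using False by (intro has_bochner_integral_unit_interval continuous_intros)
      (auto intro!: derivative_eq_intros simp: field_simps)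
  moreover have "bump k s * ripple k s = indicator {0..1} s * (sin (2 * pi * k * s) ^ 5 * cos (2 * pi * k * s))" for s
    by (auto simp: bump_def ripple_def indicator_def power_add[symmetric])
  ultimately show ?thesis by (simp add: sin_cos_period has_bochner_integral_iff)
qed (simp add: bump_def)

lemma sin4_cos2_antiderivative_identity:
  fixes S :: real
  shows "1 / 16 - S * (S ^ 5 / 6 - S ^ 3 / 24 - S / 16) + (1 - S\<^sup>2) * (5 * S ^ 4 / 6 - S\<^sup>2 / 8 - 1 / 16)
    = S ^ 4 * (1 - S\<^sup>2)"
  by (simp add: field_simps power_numeral_reduce)

lemma integral_ripple_squared:
  assumes "k \<noteq> 0" shows "(\<integral>s. ripple k s * ripple k s \<partial>lborel) = 1 / 16"
proof -
  let ?s = "\<lambda>x. sin (2 * pi * k * x)" and ?c = "\<lambda>x. cos (2 * pi * k * x)"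
  let ?F = "\<lambda>x. x / 16 + ?c x * (?s x ^ 5 / 6 - ?s x ^ 3 / 24 - ?s x / 16) / (2 * pi * k)"
  have d: "(?F has_real_derivative ?s x ^ 4 * ?c x ^ 2) (at x)" for x
  proof -
    have "(?F has_real_derivative 1 / 16 - ?s x * (?s x ^ 5 / 6 - ?s x ^ 3 / 24 - ?s x / 16)
        + ?c x ^ 2 * (5 * ?s x ^ 4 / 6 - ?s x ^ 2 / 8 - 1 / 16)) (at x)"
      using assms by (auto intro!: derivative_eq_intros simp: field_simps power2_eq_square)
    moreover have "1 / 16 - ?s x * (?s x ^ 5 / 6 - ?s x ^ 3 / 24 - ?s x / 16)
        + ?c x ^ 2 * (5 * ?s x ^ 4 / 6 - ?s x ^ 2 / 8 - 1 / 16) = ?s x ^ 4 * ?c x ^ 2"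
      unfolding cos_squared_eq by (rule sin4_cos2_antiderivative_identity)
    ultimately show ?thesis by simp
  qed
  have "has_bochner_integral lborel (\<lambda>s. indicator {0..1} s * (?s s ^ 4 * ?c s ^ 2)) (?F 1 - ?F 0)"
    by (intro has_bochner_integral_unit_interval continuous_intros d)
  moreover have "ripple k s * ripple k s = indicator {0..1} s * (?s s ^ 4 * ?c s ^ 2)" for s
    by (auto simp: ripple_def indicator_def power_numeral_reduce)
  ultimately show ?thesis by (simp add: sin_cos_period has_bochner_integral_iff)
qed

section \<open>The perturbed joint density\<close>

lemma tame_densityD:
  assumes "tame_density A A'"
  shows "0 < A x" "(A has_real_derivative A' x) (at x)" "continuous_on UNIV A'"
    "has_bochner_integral lborel A 1" "integrable lborel A" "integrable lborel A'" "continuous_on UNIV A"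
    "A \<in> borel_measurable borel"
  using assms unfolding tame_density_def
  by (auto simp: has_bochner_integral_iff intro!: borel_measurable_continuous_onI
      intro: DERIV_isCont continuous_at_imp_continuous_on)

lemma tame_density_bounded:
  assumes "tame_density A A'"
  obtains K where "\<And>x. \<bar>A x\<bar> \<le> K"
proof -
  obtain K where "\<And>x. A x \<le> K" using assms unfolding tame_density_def by blast
  then have "\<And>x. \<bar>A x\<bar> \<le> K" using tame_densityD(1)[OF assms] by (simp add: less_imp_le)
  then show ?thesis by (rule that)
qed

text \<open>The blocks live on the squares \<open>[2n, 2n+1] \<times> [0, 1]\<close>. The amplitude \<open>c n\<close> is at most half of the
product density there, so the perturbed density stays positive; the frequency \<open>k n\<close> is left free and can be
as large as desired.\<close>

locale oscillating_pair =
  fixes A A' B B' :: "real \<Rightarrow> real" and c :: "nat \<Rightarrow> real" and k :: "nat \<Rightarrow> nat"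
  assumes A: "tame_density A A'" and B: "tame_density B B'"
    and c_pos: "\<And>n. 0 < c n"
    and c_le: "\<And>n s t. 2 * real n \<le> s \<Longrightarrow> s \<le> 2 * real n + 1 \<Longrightarrow> 0 \<le> t \<Longrightarrow> t \<le> 1 \<Longrightarrow> c n \<le> A s * B t / 2"
    and k_nz: "\<And>n. k n \<noteq> 0"
begin

lemmas [measurable] = tame_densityD(8)[OF A] tame_densityD(8)[OF B]

text \<open>The sign alternates so that the slopes produced by consecutive blocks have opposite signs.\<close>

definition blip :: "nat \<Rightarrow> real \<Rightarrow> real \<Rightarrow> real" where
  "blip n s t = (-1) ^ n * c n * (bump (k n) (s - 2 * real n) * ripple (k n) t)"

definition joint :: "real \<Rightarrow> real \<Rightarrow> real" where
  "joint s t = A s * B t + (\<Sum>n. blip n s t)"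

text \<open>At each point at most one block is active, and its index can be read off from \<open>s\<close>.\<close>

lemma blip_eq_0:
  assumes "n \<noteq> nat \<lfloor>s / 2\<rfloor>" shows "blip n s t = 0"
proof (rule ccontr)
  assume "blip n s t \<noteq> 0"
  then have *: "0 \<le> s - 2 * real n" "s - 2 * real n \<le> 1"
    by (auto simp: blip_def bump_def indicator_def split: if_splits)
  have "\<lfloor>s / 2\<rfloor> = int n" by (rule floor_unique) (use * in auto)
  then show False using assms by simp
qed

lemma sum_blip_eq: "(\<Sum>n<m. blip n s t) = (if nat \<lfloor>s / 2\<rfloor> < m then blip (nat \<lfloor>s / 2\<rfloor>) s t else 0)"
proof -
  have "(\<Sum>n<m. blip n s t) = (\<Sum>n<m. if n = nat \<lfloor>s / 2\<rfloor> then blip n s t else 0)"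
    by (rule sum.cong) (auto simp: blip_eq_0)
  then show ?thesis by simp
qed

lemma suminf_blip_eq: "(\<Sum>n. blip n s t) = blip (nat \<lfloor>s / 2\<rfloor>) s t"
  using suminf_finite[of "{nat \<lfloor>s / 2\<rfloor>}" "\<lambda>n. blip n s t"] by (auto simp: blip_eq_0)

lemma sum_blip_tendsto: "(\<lambda>m. \<Sum>n<m. blip n s t) \<longlonglongrightarrow> (\<Sum>n. blip n s t)"
proof -
  have "\<forall>\<^sub>F m in sequentially. nat \<lfloor>s / 2\<rfloor> < m" by (rule eventually_gt_at_top)
  then have "\<forall>\<^sub>F m in sequentially. (\<Sum>n<m. blip n s t) = (\<Sum>n. blip n s t)"
    by eventually_elim (simp add: sum_blip_eq suminf_blip_eq)
  then show ?thesis by (rule tendsto_eventually)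
qed

lemma abs_blip_le: "\<bar>blip n s t\<bar> \<le> A s * B t / 2"
proof (cases "blip n s t = 0")
  case True
  then show ?thesis using tame_densityD(1)[OF A, of s] tame_densityD(1)[OF B, of t] by simp
next
  case False
  then have "0 \<le> s - 2 * real n" "s - 2 * real n \<le> 1" "0 \<le> t" "t \<le> 1"
    by (auto simp: blip_def bump_def ripple_def indicator_def split: if_splits)
  then have "c n \<le> A s * B t / 2" by (intro c_le) auto
  moreover have "\<bar>bump (k n) (s - 2 * real n)\<bar> * \<bar>ripple (k n) t\<bar> \<le> 1"
    by (intro mult_le_one abs_bump_le abs_ripple_le) auto
  then have "\<bar>blip n s t\<bar> \<le> c n"
    using c_pos[of n] by (simp add: blip_def abs_mult power_abs mult_left_le)
  ultimately show ?thesis by linarith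
qed

lemma abs_sum_blip_le: "\<bar>\<Sum>n<m. blip n s t\<bar> \<le> A s * B t / 2"
  using abs_blip_le[of "nat \<lfloor>s / 2\<rfloor>" s t] abs_ge_zero order_trans
  unfolding sum_blip_eq by auto

lemma joint_pos: "0 < joint s t"
proof -
  have "0 < A s * B t" using tame_densityD(1)[OF A] tame_densityD(1)[OF B] by simp
  then show ?thesis
    using abs_blip_le[of "nat \<lfloor>s / 2\<rfloor>" s t] unfolding joint_def suminf_blip_eq by linarith
qed

lemma bump_ripple_measurable [measurable]:
  "bump j \<in> borel_measurable borel" "ripple j \<in> borel_measurable borel"
  by (auto intro: borel_measurable_continuous_onI continuous_on_bump continuous_on_ripple)

lemma joint_measurable [measurable]:
  "case_prod joint \<in> borel_measurable (borel \<Otimes>\<^sub>M borel)"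
  unfolding joint_def blip_def by measurable

lemma joint_fst: "has_bochner_integral lborel (joint s) (A s)"
proof -
  let ?N = "nat \<lfloor>s / 2\<rfloor>"
  have "has_bochner_integral lborel
      (\<lambda>t. A s * B t + (-1) ^ ?N * c ?N * bump (k ?N) (s - 2 * real ?N) * ripple (k ?N) t)
      (A s * 1 + (-1) ^ ?N * c ?N * bump (k ?N) (s - 2 * real ?N) * 0)"
    by (intro has_bochner_integral_add has_bochner_integral_mult_right
        has_bochner_integral_ripple tame_densityD(4)[OF B])
  moreover have "joint s = (\<lambda>t. A s * B t + blip ?N s t)"
    by (simp add: fun_eq_iff joint_def suminf_blip_eq)
  ultimately show ?thesis by (simp add: blip_def mult.assoc)
qed

lemma has_bochner_integral_bump_shift: "has_bochner_integral lborel (\<lambda>s. bump j (s - d)) 0"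
  using lborel_has_bochner_integral_real_affine_iff[of 1 "bump j" 0 "- d"] has_bochner_integral_bump[of j]
  by simp

text \<open>Along a horizontal line infinitely many blocks contribute; each of them has integral zero, and the partial
sums are dominated by half of the product density.\<close>

lemma joint_snd: "has_bochner_integral lborel (\<lambda>s. joint s t) (B t)"
proof -
  have part: "has_bochner_integral lborel (\<lambda>s. \<Sum>n<m. blip n s t) 0" for m
  proof -
    have "has_bochner_integral lborel (\<lambda>s. blip n s t) ((-1) ^ n * c n * (0 * ripple (k n) t))" for n
      unfolding blip_def
      by (intro has_bochner_integral_mult_right has_bochner_integral_mult_left has_bochner_integral_bump_shift)
    then show ?thesis using has_bochner_integral_sum[of "{..<m}" lborel "\<lambda>n s. blip n s t" "\<lambda>_. 0"] by simp
  qed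
  have dom: "integrable lborel (\<lambda>s. A s * B t / 2)" using tame_densityD(5)[OF A] by simp
  have meas: "(\<lambda>s. \<Sum>n. blip n s t) \<in> borel_measurable lborel"
    "\<And>m. (\<lambda>s. \<Sum>n<m. blip n s t) \<in> borel_measurable lborel"
    unfolding blip_def by measurable
  have lim: "AE s in lborel. (\<lambda>m. \<Sum>n<m. blip n s t) \<longlonglongrightarrow> (\<Sum>n. blip n s t)"
    by (intro AE_I2 sum_blip_tendsto)
  have bnd: "\<And>m. AE s in lborel. norm (\<Sum>n<m. blip n s t) \<le> A s * B t / 2"
    using abs_sum_blip_le by auto
  have "(\<lambda>m. 0) \<longlonglongrightarrow> (\<integral>s. (\<Sum>n. blip n s t) \<partial>lborel)"
    using integral_dominated_convergence[OF meas dom lim bnd] part by (simp add: has_bochner_integral_iff)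
  then have "(\<integral>s. (\<Sum>n. blip n s t) \<partial>lborel) = 0" by (simp add: LIMSEQ_const_iff)
  then have "has_bochner_integral lborel (\<lambda>s. \<Sum>n. blip n s t) 0"
    using integrable_dominated_convergence[OF meas dom lim bnd] by (simp add: has_bochner_integral_iff)
  from has_bochner_integral_add[OF has_bochner_integral_mult_left[OF tame_densityD(4)[OF A], of "B t"] this]
  show ?thesis unfolding joint_def by simp
qed

text \<open>The density of the sum of two independent variables with densities \<open>A\<close> and \<open>B\<close>, the unnormalised
contribution of block \<open>n\<close> to the density of the sum, and the derivatives of both.\<close>

definition indep_density :: "real \<Rightarrow> real" where "indep_density w = (\<integral>s. A s * B (w - s) \<partial>lborel)"
definition indep_density' :: "real \<Rightarrow> real" where "indep_density' w = (\<integral>s. A' s * B (w - s) \<partial>lborel)"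
definition wave :: "nat \<Rightarrow> real \<Rightarrow> real" where
  "wave n w = (\<integral>s. bump (k n) (s - 2 * real n) * ripple (k n) (w - s) \<partial>lborel)"
definition wave' :: "nat \<Rightarrow> real \<Rightarrow> real" where
  "wave' n w = (\<integral>s. 6 * pi * k n * ripple (k n) (s - 2 * real n) * ripple (k n) (w - s) \<partial>lborel)"

lemma integrable_shift: "integrable lborel f \<Longrightarrow> integrable lborel (\<lambda>s. f (s - d))" for f :: "real \<Rightarrow> real"
  using lborel_integrable_real_affine[of f 1 "- d"] by simp

lemma indep_density_deriv: "(indep_density has_real_derivative indep_density' w) (at w)" "continuous_on UNIV indep_density'"
proof -
  obtain K where K: "\<And>x. \<bar>B x\<bar> \<le> K" using tame_density_bounded[OF B] by blast
  note a = tame_densityD[OF A] and b = tame_densityD[OF B]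
  show "(indep_density has_real_derivative indep_density' w) (at w)"
    unfolding indep_density_def indep_density'_def
    by (rule has_real_derivative_convolution[OF a(5) a(2) a(3) a(6) b(7) b(5) K])
  show "continuous_on UNIV indep_density'"
    unfolding indep_density'_def by (rule continuous_on_convolution[OF a(6) b(7) K])
qed

lemma wave_deriv: "(wave n has_real_derivative wave' n w) (at w)" "continuous_on UNIV (wave' n)"
proof -
  have i: "integrable lborel (\<lambda>s. bump (k n) (s - 2 * real n))"
    using has_bochner_integral_bump by (intro integrable_shift) (auto simp: has_bochner_integral_iff)
  have i': "integrable lborel (\<lambda>s. 6 * pi * k n * ripple (k n) (s - 2 * real n))"
    using has_bochner_integral_ripple
    by (intro integrable_mult_right integrable_shift) (auto simp: has_bochner_integral_iff)
  have d: "((\<lambda>s. bump (k n) (s - 2 * real n)) has_real_derivative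
      6 * pi * k n * ripple (k n) (s - 2 * real n)) (at s)" for s
    using DERIV_shift[of "bump (k n)" _ s "- (2 * real n)"] has_real_derivative_bump[of "k n" "s - 2 * real n"]
    by simp
  have c: "continuous_on UNIV (\<lambda>s. 6 * pi * k n * ripple (k n) (s - 2 * real n))"
    by (intro continuous_intros continuous_on_compose2[OF continuous_on_ripple]) auto
  have r: "integrable lborel (ripple (k n))" using has_bochner_integral_ripple by (simp add: has_bochner_integral_iff)
  show "(wave n has_real_derivative wave' n w) (at w)"
    unfolding wave_def wave'_def
    by (rule has_real_derivative_convolution[OF i d c i' continuous_on_ripple r abs_ripple_le])
  show "continuous_on UNIV (wave' n)"
    unfolding wave'_def by (rule continuous_on_convolution[OF i' continuous_on_ripple abs_ripple_le])
qed

lemma wave_eq_0: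
  assumes "2 * real n + 2 < w"
  shows "wave n w = 0" "wave' n w = 0"
proof -
  have disjoint: "bump (k n) (s - 2 * real n) * ripple (k n) (w - s) = 0"
    "ripple (k n) (s - 2 * real n) * ripple (k n) (w - s) = 0" for s
    using assms by (auto simp: bump_def ripple_def indicator_def)
  show "wave n w = 0" "wave' n w = 0"
    unfolding wave_def wave'_def mult.assoc disjoint by simp_all
qed

text \<open>The antidiagonal \<open>s + t = 2n + 1\<close> is the one that crosses the whole \<open>n\<close>-th square; there the block changes
the slope of the density of the sum, in proportion to \<open>k n\<close>, and leaves its value alone.\<close>

lemma wave_peak: "wave n (2 * real n + 1) = 0" "wave' n (2 * real n + 1) = 3 * pi * k n / 8"
proof -
  have shift: "(\<integral>s. f (s - 2 * real n) * ripple (k n) (2 * real n + 1 - s) \<partial>lborel)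
      = (\<integral>s. f s * ripple (k n) s \<partial>lborel)" for f :: "real \<Rightarrow> real"
    by (subst lborel_integral_real_affine[where c = 1 and t = "2 * real n"])
      (auto simp: ripple_reflect)
  show "wave n (2 * real n + 1) = 0"
    unfolding wave_def shift by (rule integral_bump_ripple)
  show "wave' n (2 * real n + 1) = 3 * pi * k n / 8"
    unfolding wave'_def using shift[of "\<lambda>s. 6 * pi * k n * ripple (k n) s"]
      integral_ripple_squared[OF k_nz, of n] by (simp add: mult.assoc)
qed

definition sum_density :: "real \<Rightarrow> real" where
  "sum_density w = (\<integral>s. joint s (w - s) \<partial>lborel)"

text \<open>The second coordinate of a point in a block is nonnegative, so an antidiagonal \<open>s + t = w\<close> meets only blocks
with \<open>2n \<le> w\<close>. Hence on every left half-line the density of the sum is a finite sum of continuously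
differentiable functions, however fast the frequencies \<open>k n\<close> grow.\<close>

lemma sum_density_eq:
  assumes "w < 2 * real m"
  shows "has_bochner_integral lborel (\<lambda>s. joint s (w - s)) (indep_density w + (\<Sum>n<m. (-1) ^ n * c n * wave n w))"
proof -
  have "joint s (w - s) = A s * B (w - s) + (\<Sum>n<m. blip n s (w - s))" for s
  proof (cases "nat \<lfloor>s / 2\<rfloor> < m")
    case True
    then show ?thesis unfolding joint_def suminf_blip_eq sum_blip_eq by simp
  next
    case False
    have "blip n s (w - s) = 0" for n
    proof (cases "0 \<le> s")
      case True
      have "real m \<le> real (nat \<lfloor>s / 2\<rfloor>)" using False by simp
      also have "\<dots> \<le> s / 2" using True by (intro of_nat_floor) simp
      finally show ?thesis using assms by (simp add: blip_def ripple_def)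
    qed (simp add: blip_def bump_def)
    then show ?thesis unfolding joint_def by simp
  qed
  moreover have "has_bochner_integral lborel (\<lambda>s. A s * B (w - s)) (indep_density w)"
  proof -
    obtain K where K: "\<And>x. \<bar>B x\<bar> \<le> K" using tame_density_bounded[OF B] by blast
    have "integrable lborel (\<lambda>s. A s * B (w - s))"
      by (rule integrable_bounded_mult[OF tame_densityD(5)[OF A] _ K]) measurable
    then show ?thesis by (simp add: has_bochner_integral_iff indep_density_def)
  qed
  moreover have "has_bochner_integral lborel (\<lambda>s. blip n s (w - s)) ((-1) ^ n * c n * wave n w)" for n
  proof -
    have "integrable lborel (\<lambda>s. bump (k n) (s - 2 * real n))"
      using has_bochner_integral_bump_shift by (auto simp: has_bochner_integral_iff)
    then have "integrable lborel (\<lambda>s. bump (k n) (s - 2 * real n) * ripple (k n) (w - s))"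
      by (rule integrable_bounded_mult[OF _ _ abs_ripple_le]) measurable
    then have "has_bochner_integral lborel (\<lambda>s. bump (k n) (s - 2 * real n) * ripple (k n) (w - s)) (wave n w)"
      by (simp add: has_bochner_integral_iff wave_def)
    then show ?thesis unfolding blip_def by (rule has_bochner_integral_mult_right)
  qed
  ultimately show ?thesis
    by (simp only: has_bochner_integral_add has_bochner_integral_sum)
qed

lemma sum_density_eq_sum: "w < 2 * real m \<Longrightarrow> sum_density w = indep_density w + (\<Sum>n<m. (-1) ^ n * c n * wave n w)"
  using sum_density_eq unfolding sum_density_def by (simp add: has_bochner_integral_iff)

lemma joint_antidiagonal: "has_bochner_integral lborel (\<lambda>s. joint s (w - s)) (sum_density w)"
proof -
  obtain m :: nat where "w / 2 < real m" using reals_Archimedean2 by blast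
  then have "w < 2 * real m" by simp
  from sum_density_eq[OF this] show ?thesis by (simp add: sum_density_def has_bochner_integral_iff)
qed

lemma sum_density_pos: "0 < sum_density w"
proof -
  have i: "integrable lborel (\<lambda>s. joint s (w - s))" and e: "sum_density w = (\<integral>s. joint s (w - s) \<partial>lborel)"
    using joint_antidiagonal[of w] by (auto simp: has_bochner_integral_iff)
  have nn: "AE s in lborel. 0 \<le> joint s (w - s)" using joint_pos by (auto intro: less_imp_le)
  have "\<not> (AE s in lborel. joint s (w - s) = 0)"
  proof
    assume "AE s in lborel. joint s (w - s) = 0"
    then have "AE s in (lborel::real measure). False" using joint_pos by (auto simp: less_imp_neq[symmetric] elim!: eventually_mono)
    then show False by (simp add: AE_iff_measurable[OF _ refl])
  qed
  then have "sum_density w \<noteq> 0"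
    using integral_nonneg_eq_0_iff_AE[OF i nn] e by simp
  moreover have "0 \<le> sum_density w" unfolding e by (rule integral_nonneg_AE[OF nn])
  ultimately show ?thesis by simp
qed

lemma sum_density_deriv_sum:
  assumes "w < 2 * real m"
  shows "(sum_density has_real_derivative indep_density' w + (\<Sum>n<m. (-1) ^ n * c n * wave' n w)) (at w)"
proof -
  have "\<forall>\<^sub>F x in nhds w. x < 2 * real m"
    using assms order_tendstoD(2)[OF filterlim_ident, of w "2 * real m"] by simp
  then have ev: "\<forall>\<^sub>F x in nhds w. sum_density x = indep_density x + (\<Sum>n<m. (-1) ^ n * c n * wave n x)"
    by eventually_elim (rule sum_density_eq_sum)
  have "((\<lambda>x. indep_density x + (\<Sum>n<m. (-1) ^ n * c n * wave n x)) has_real_derivative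
      indep_density' w + (\<Sum>n<m. (-1) ^ n * c n * wave' n w)) (at w)"
    by (intro DERIV_add indep_density_deriv DERIV_sum DERIV_cmult wave_deriv)
  then show ?thesis using DERIV_cong_ev[OF refl ev refl] by simp
qed

lemma sum_density_deriv: "(sum_density has_real_derivative deriv sum_density w) (at w)"
proof -
  obtain m :: nat where "w / 2 < real m" using reals_Archimedean2 by blast
  then have "w < 2 * real m" by simp
  from sum_density_deriv_sum[OF this] show ?thesis by (metis DERIV_imp_deriv)
qed

lemma continuous_deriv_conv: "continuous_on UNIV (deriv sum_density)"
proof -
  have "isCont (deriv sum_density) w" for w
  proof -
    obtain m :: nat where m: "w / 2 < real m" using reals_Archimedean2 by blast
    have "continuous_on UNIV (\<lambda>w. indep_density' w + (\<Sum>n<m. (-1) ^ n * c n * wave' n w))"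
      by (intro continuous_intros indep_density_deriv wave_deriv)
    then have "continuous_on {..<2 * real m} (\<lambda>w. indep_density' w + (\<Sum>n<m. (-1) ^ n * c n * wave' n w))"
      by (rule continuous_on_subset) simp
    then have "continuous_on {..<2 * real m} (deriv sum_density)"
      by (rule continuous_on_eq) (auto simp: DERIV_imp_deriv[OF sum_density_deriv_sum[of _ m]])
    then show ?thesis using m by (simp add: continuous_on_eq_continuous_at)
  qed
  then show ?thesis by (simp add: continuous_at_imp_continuous_on)
qed

lemma sum_density_peak:
  "sum_density (2 * real n + 1) = indep_density (2 * real n + 1)"
  "deriv sum_density (2 * real n + 1) = indep_density' (2 * real n + 1) + (-1) ^ n * (c n * (3 * pi * k n / 8))"
proof -
  have lt: "2 * real n + 1 < 2 * real (Suc n)" by simp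
  have z: "wave j (2 * real n + 1) = 0" "wave' j (2 * real n + 1) = 0" if "j < n" for j
    using that by (intro wave_eq_0; linarith)+
  show "sum_density (2 * real n + 1) = indep_density (2 * real n + 1)"
    unfolding sum_density_eq_sum[OF lt] by (simp add: z wave_peak)
  show "deriv sum_density (2 * real n + 1) = indep_density' (2 * real n + 1) + (-1) ^ n * (c n * (3 * pi * k n / 8))"
    unfolding DERIV_imp_deriv[OF sum_density_deriv_sum[OF lt]] by (simp add: z wave_peak mult.assoc)
qed

end

section \<open>Passing to exponentials and sums\<close>

lemma distributed_exp:
  fixes X :: "'a \<Rightarrow> real" and A g :: "real \<Rightarrow> real"
  assumes X: "distributed M lborel X (\<lambda>s. ennreal (A s))"
    and A: "integrable lborel A" and Ag: "\<And>s. A s = exp s * g (exp s)"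
    and g: "g \<in> borel_measurable borel" "\<And>x. 0 \<le> g x" "AE x in lborel. x \<le> 0 \<longrightarrow> g x = 0"
  shows "distributed M lborel (\<lambda>\<omega>. exp (X \<omega>)) (\<lambda>x. ennreal (g x))"
  unfolding distributed_def
proof (intro conjI)
  note [measurable] = g(1)
  have [measurable]: "X \<in> borel_measurable M" using distributed_measurable[OF X] by simp
  show "(\<lambda>x. ennreal (g x)) \<in> borel_measurable lborel" by measurable
  show "(\<lambda>\<omega>. exp (X \<omega>)) \<in> measurable M lborel" by measurable
  have nnA: "0 \<le> A s" for s by (simp add: Ag g(2))
  show "distr M lborel (\<lambda>\<omega>. exp (X \<omega>)) = density lborel (\<lambda>x. ennreal (g x))"
  proof (rule measure_eqI)
    fix E assume "E \<in> sets (distr M lborel (\<lambda>\<omega>. exp (X \<omega>)))"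
    then have [measurable]: "E \<in> sets borel" by simp
    define F where "F = (\<lambda>x. g x * indicator E x)"
    have [measurable]: "F \<in> borel_measurable borel" unfolding F_def by measurable
    have eq: "exp s * F (exp s) = A s * indicator (exp -` E) s" for s
      by (simp add: F_def Ag indicator_def)
    have "integrable lborel (\<lambda>s. A s * indicator (exp -` E) s)"
      using A measurable_sets[of exp borel borel E] by (intro integrable_real_mult_indicator) auto
    then obtain b where b: "has_bochner_integral lborel (\<lambda>s. exp s * F (exp s)) b"
      unfolding eq has_bochner_integral_iff by blast
    then have b': "has_bochner_integral lborel (\<lambda>x. indicator {0<..} x * F x) b"
      by (simp add: has_bochner_integral_exp_iff)
    have "emeasure (distr M lborel (\<lambda>\<omega>. exp (X \<omega>))) E = emeasure (distr M lborel X) (exp -` E)"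
      using measurable_sets[of exp borel borel E]
      by (simp add: emeasure_distr vimage_def) 
    also have "\<dots> = (\<integral>\<^sup>+s. ennreal (A s) * indicator (exp -` E) s \<partial>lborel)"
      using measurable_sets[of exp borel borel E] distributed_borel_measurable[OF X]
      by (simp add: distributed_distr_eq_density[OF X] emeasure_density)
    also have "\<dots> = (\<integral>\<^sup>+s. ennreal (exp s * F (exp s)) \<partial>lborel)"
      unfolding eq by (intro nn_integral_cong) (auto simp: indicator_def)
    also have "\<dots> = ennreal b"
      using b g(2) by (subst nn_integral_eq_integral) (auto simp: has_bochner_integral_iff F_def)
    also have "\<dots> = (\<integral>\<^sup>+x. ennreal (indicator {0<..} x * F x) \<partial>lborel)"
      using b' g(2) by (subst nn_integral_eq_integral) (auto simp: has_bochner_integral_iff F_def)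
    also have "\<dots> = (\<integral>\<^sup>+x. ennreal (g x) * indicator E x \<partial>lborel)"
    proof (rule nn_integral_cong_AE)
      show "AE x in lborel. ennreal (indicator {0<..} x * F x) = ennreal (g x) * indicator E x"
        using g(3) by eventually_elim (auto simp: F_def indicator_def)
    qed
    also have "\<dots> = emeasure (density lborel (\<lambda>x. ennreal (g x))) E"
      by (simp add: emeasure_density)
    finally show "emeasure (distr M lborel (\<lambda>\<omega>. exp (X \<omega>))) E = emeasure (density lborel (\<lambda>x. ennreal (g x))) E" .
  qed simp
qed

lemma distributed_add:
  fixes q :: "real \<Rightarrow> real \<Rightarrow> ennreal"
  assumes [measurable]: "case_prod q \<in> borel_measurable (borel \<Otimes>\<^sub>M borel)"
  shows "distributed (density (lborel \<Otimes>\<^sub>M lborel) (case_prod q)) lborel (\<lambda>\<omega>. fst \<omega> + snd \<omega>)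
    (\<lambda>w. \<integral>\<^sup>+s. q s (w - s) \<partial>lborel)"
  unfolding distributed_def
proof (intro conjI)
  show "(\<lambda>w. \<integral>\<^sup>+s. q s (w - s) \<partial>lborel) \<in> borel_measurable lborel" by measurable
  show "(\<lambda>\<omega>. fst \<omega> + snd \<omega>) \<in> measurable (density (lborel \<Otimes>\<^sub>M lborel) (case_prod q)) lborel" by measurable
  show "distr (density (lborel \<Otimes>\<^sub>M lborel) (case_prod q)) lborel (\<lambda>\<omega>. fst \<omega> + snd \<omega>)
      = density lborel (\<lambda>w. \<integral>\<^sup>+s. q s (w - s) \<partial>lborel)" (is "?D = ?R")
  proof (rule measure_eqI)
    fix E assume "E \<in> sets ?D"
    then have [measurable]: "E \<in> sets borel" by simp
    have meas: "(\<lambda>\<omega>. case_prod q \<omega> * indicator E (fst \<omega> + snd \<omega>)) \<in> borel_measurable (lborel \<Otimes>\<^sub>M lborel)"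
      by measurable
    have "emeasure ?D E = (\<integral>\<^sup>+x. indicator E x \<partial>?D)" by simp
    also have "\<dots> = (\<integral>\<^sup>+\<omega>. case_prod q \<omega> * indicator E (fst \<omega> + snd \<omega>) \<partial>(lborel \<Otimes>\<^sub>M lborel))"
      by (subst nn_integral_distr, measurable) (subst nn_integral_density, auto)
    also have "\<dots> = (\<integral>\<^sup>+s. \<integral>\<^sup>+t. q s t * indicator E (s + t) \<partial>lborel \<partial>lborel)"
      using lborel.nn_integral_fst[OF meas, symmetric] by simp
    also have "\<dots> = (\<integral>\<^sup>+s. \<integral>\<^sup>+w. q s (w - s) * indicator E w \<partial>lborel \<partial>lborel)"
    proof (rule nn_integral_cong)
      fix s :: real
      have "(\<lambda>t. q s t * indicator E (s + t)) \<in> borel_measurable borel"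
        using measurable_compose[OF measurable_Pair1'[of s lborel lborel] meas] by simp
      then show "(\<integral>\<^sup>+t. q s t * indicator E (s + t) \<partial>lborel) = (\<integral>\<^sup>+w. q s (w - s) * indicator E w \<partial>lborel)"
        by (subst nn_integral_real_affine[where c = 1 and t = "- s"]) simp_all
    qed
    also have "\<dots> = (\<integral>\<^sup>+w. \<integral>\<^sup>+s. q s (w - s) * indicator E w \<partial>lborel \<partial>lborel)"
      by (rule lborel_pair.Fubini'[symmetric]) measurable
    also have "\<dots> = (\<integral>\<^sup>+w. (\<integral>\<^sup>+s. q s (w - s) \<partial>lborel) * indicator E w \<partial>lborel)"
      by (intro nn_integral_cong nn_integral_multc) measurable
    also have "\<dots> = emeasure ?R E"
      by (subst emeasure_density) auto
    finally show "emeasure ?D E = emeasure ?R E" .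
  qed simp
qed

text \<open>The preimage of a null set under the coordinatewise exponential is the image of a null set under the
coordinatewise logarithm, which is differentiable and therefore maps null sets to null sets.\<close>

lemma absolutely_continuous_exp_pair:
  fixes M :: "(real \<times> real) measure"
  assumes M: "absolutely_continuous lborel M" "sets M = sets borel"
  shows "absolutely_continuous lborel (distr M borel (\<lambda>\<omega>. (exp (fst \<omega>), exp (snd \<omega>))))"
  unfolding absolutely_continuous_def
proof
  let ?T = "\<lambda>\<omega>::real \<times> real. (exp (fst \<omega>), exp (snd \<omega>))"
  have "continuous_on UNIV ?T" by (intro continuous_intros)
  then have T: "?T \<in> measurable borel borel" by (rule borel_measurable_continuous_onI)
  then have T'[measurable]: "?T \<in> measurable M borel" by (simp add: measurable_cong_sets[OF M(2) refl])
  fix N :: "(real \<times> real) set" assume N: "N \<in> null_sets lborel"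
  then have NS: "N \<in> sets borel" by auto
  define P where "P = N \<inter> ({0<..} \<times> {0<..})"
  let ?L = "\<lambda>z::real \<times> real. (ln (fst z), ln (snd z))"
  have "negligible N" using N by (simp add: negligible_iff_null_sets null_sets_completionI)
  then have "negligible P" unfolding P_def by (rule negligible_subset) auto
  moreover have "?L differentiable_on P"
    unfolding differentiable_on_def
  proof
    fix z assume "z \<in> P"
    then have z: "0 < fst z" "0 < snd z" by (auto simp: P_def)
    have "((\<lambda>z. ln (fst z)) has_derivative (\<lambda>h. fst h / fst z)) (at z within P)"
      "((\<lambda>z. ln (snd z)) has_derivative (\<lambda>h. snd h / snd z)) (at z within P)"
      using z by (auto intro!: derivative_eq_intros simp: divide_inverse)
    from has_derivative_Pair[OF this] show "?L differentiable at z within P"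
      unfolding differentiable_def by blast
  qed
  ultimately have "negligible (?L ` P)"
    by (intro negligible_differentiable_image_negligible) auto
  moreover have "?T -` N \<subseteq> ?L ` P"
  proof
    fix z assume "z \<in> ?T -` N"
    then have "?T z \<in> P" by (simp add: P_def)
    moreover have "z = ?L (?T z)" by (simp add: prod_eq_iff)
    ultimately show "z \<in> ?L ` P" by blast
  qed
  ultimately have "negligible (?T -` N)" by (rule negligible_subset)
  moreover have V: "?T -` N \<in> sets borel" using measurable_sets[OF T NS] by simp
  ultimately have "?T -` N \<in> null_sets lborel"
    by (simp add: negligible_iff_null_sets null_sets_completion_iff)
  then have "?T -` N \<in> null_sets M" using M(1) unfolding absolutely_continuous_def by blast
  then show "N \<in> null_sets (distr M borel ?T)"
    using NS sets_eq_imp_space_eq[OF M(2)] by (simp add: null_sets_distr_iff)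
qed

lemma distributed_marginals:
  fixes q :: "real \<Rightarrow> real \<Rightarrow> real"
  assumes [measurable]: "case_prod q \<in> borel_measurable (borel \<Otimes>\<^sub>M borel)"
    and nonneg: "\<And>s t. 0 \<le> q s t"
    and A: "\<And>s. has_bochner_integral lborel (q s) (A s)" "has_bochner_integral lborel A 1"
    and B: "\<And>t. has_bochner_integral lborel (\<lambda>s. q s t) (B t)"
  defines "M \<equiv> density (lborel \<Otimes>\<^sub>M lborel) (\<lambda>(s, t). ennreal (q s t))"
  shows "prob_space M" "distributed M lborel fst (\<lambda>s. ennreal (A s))" "distributed M lborel snd (\<lambda>t. ennreal (B t))"
proof -
  have iA: "(\<integral>\<^sup>+t. ennreal (q s t) \<partial>lborel) = ennreal (A s)" for s
    using A(1)[of s] nonneg by (subst nn_integral_eq_integral) (auto simp: has_bochner_integral_iff)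
  have iB: "(\<integral>\<^sup>+s. ennreal (q s t) \<partial>lborel) = ennreal (B t)" for t
    using B[of t] nonneg by (subst nn_integral_eq_integral) (auto simp: has_bochner_integral_iff)
  have A0: "0 \<le> A s" for s
    using A(1)[of s] nonneg Bochner_Integration.integral_nonneg[of lborel "q s"]
    by (auto simp: has_bochner_integral_iff)
  show prob: "prob_space M"
  proof (rule prob_spaceI)
    have meas: "(\<lambda>(s, t). ennreal (q s t)) \<in> borel_measurable (lborel \<Otimes>\<^sub>M lborel)"
      by measurable
    have "emeasure M (space M) = (\<integral>\<^sup>+z. (case z of (s, t) \<Rightarrow> ennreal (q s t)) \<partial>(lborel \<Otimes>\<^sub>M lborel))"
      unfolding M_def using emeasure_density[OF meas sets.top] by (simp add: space_pair_measure)
    also have "\<dots> = (\<integral>\<^sup>+s. \<integral>\<^sup>+t. ennreal (q s t) \<partial>lborel \<partial>lborel)"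
      using lborel.nn_integral_fst[of "\<lambda>(s, t). ennreal (q s t)" lborel] by simp
    also have "\<dots> = 1"
      unfolding iA using A(2) A0 by (subst nn_integral_eq_integral) (auto simp: has_bochner_integral_iff)
    finally show "emeasure M (space M) = 1" .
  qed
  interpret prob_space M by fact
  have joint: "distributed M (lborel \<Otimes>\<^sub>M lborel) (\<lambda>z. (fst z, snd z)) (\<lambda>(s, t). ennreal (q s t))"
    unfolding distributed_def M_def by (auto simp: distr_id2)
  have sf: "sigma_finite_measure (lborel :: real measure)" by unfold_locales
  show "distributed M lborel fst (\<lambda>s. ennreal (A s))"
    using distr_marginal1[OF sf sf joint] by (simp add: iA)
  show "distributed M lborel snd (\<lambda>t. ennreal (B t))"
    using distr_marginal2[OF sf sf joint] by (simp add: iB)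
qed

text \<open>The density of \<open>exp Y\<close> when \<open>Y\<close> has density \<open>Q\<close>.\<close>

definition exp_density :: "(real \<Rightarrow> real) \<Rightarrow> real \<Rightarrow> real" where
  "exp_density Q x = indicator {0<..} x * (Q (ln x) / x)"

lemma exp_density_regular:
  fixes Q Q' :: "real \<Rightarrow> real"
  assumes "prob_space M" and Y: "distributed M lborel Y (\<lambda>s. ennreal (Q s))" and Q: "integrable lborel Q" "\<And>s. 0 < Q s"
    and Q': "\<And>s. (Q has_real_derivative Q' s) (at s)" "continuous_on UNIV Q'"
  shows "distributed M lborel (\<lambda>\<omega>. exp (Y \<omega>)) (\<lambda>x. ennreal (exp_density Q x))"
    and "regular_density (exp_density Q)"
    and "lin_function (exp_density Q) (exp s) = 1 - Q' s / Q s"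
proof -
  interpret prob_space M by fact
  have [measurable]: "Q \<in> borel_measurable borel" using Q(1) by simp
  have meas[measurable]: "exp_density Q \<in> borel_measurable borel"
    unfolding exp_density_def[abs_def] by measurable
  have nn: "0 \<le> exp_density Q x" for x
    using Q(2)[of "ln x"] by (auto simp: exp_density_def indicator_def)
  show dist: "distributed M lborel (\<lambda>\<omega>. exp (Y \<omega>)) (\<lambda>x. ennreal (exp_density Q x))"
    by (rule distributed_exp[OF Y Q(1) _ meas nn]) (auto simp: exp_density_def)
  have d: "(exp_density Q has_real_derivative (Q' (ln x) - Q (ln x)) / x\<^sup>2) (at x)" if "0 < x" for x
  proof -
    have *: "((\<lambda>x. Q (ln x) / x) has_real_derivative (Q' (ln x) - Q (ln x)) / x\<^sup>2) (at x)"
      using that by (auto intro!: derivative_eq_intros DERIV_chain2[OF Q'(1)] simp: power2_eq_square field_simps)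
    have "\<forall>\<^sub>F y in nhds x. 0 < y"
      using that order_tendstoD(1)[OF filterlim_ident, of 0 x] by simp
    then have "\<forall>\<^sub>F y in nhds x. exp_density Q y = Q (ln y) / y"
      by eventually_elim (simp add: exp_density_def)
    from DERIV_cong_ev[OF refl this refl] * show ?thesis by simp
  qed
  have cQ: "continuous_on UNIV Q" by (intro continuous_at_imp_continuous_on ballI) (auto intro: DERIV_isCont Q'(1))
  have "exp_density Q C1_differentiable_on {0<..}"
    unfolding C1_differentiable_on_def
  proof (intro exI conjI ballI)
    show "(exp_density Q has_vector_derivative (Q' (ln x) - Q (ln x)) / x\<^sup>2) (at x)" if "x \<in> {0<..}" for x
      using d[of x] that by (simp add: has_real_derivative_iff_has_vector_derivative)
    show "continuous_on {0<..} (\<lambda>x. (Q' (ln x) - Q (ln x)) / x\<^sup>2)"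
      by (intro continuous_intros continuous_on_compose2[OF cQ] continuous_on_compose2[OF Q'(2)]) auto
  qed
  moreover have "prob_space (density lborel (\<lambda>x. ennreal (exp_density Q x)))"
    using prob_space_distr[of "\<lambda>\<omega>. exp (Y \<omega>)" lborel] distributed_distr_eq_density[OF dist]
      distributed_measurable[OF dist] by simp
  moreover have "AE x in density lborel (\<lambda>x. ennreal (exp_density Q x)). 0 < x"
    by (subst AE_density) (auto simp: exp_density_def indicator_def)
  moreover have "exp_density Q x \<noteq> 0" if "0 < x" for x
    using that Q(2)[of "ln x"] by (simp add: exp_density_def)
  ultimately show "regular_density (exp_density Q)"
    unfolding regular_density_def positive_rv_density_def using nn meas by auto
  have "deriv (exp_density Q) (exp s) = (Q' s - Q s) / (exp s)\<^sup>2"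
    using DERIV_imp_deriv[OF d[of "exp s"]] by simp
  then show "lin_function (exp_density Q) (exp s) = 1 - Q' s / Q s"
    using Q(2)[of s] by (simp add: lin_function_def exp_density_def power2_eq_square field_simps)
qed

section \<open>The random vector with oscillating Lin function\<close>

lemma Limsup_ereal_eq_infinity:
  fixes f :: "'a \<Rightarrow> real"
  assumes "\<And>r. \<exists>\<^sub>F x in F. r \<le> f x"
  shows "Limsup F (\<lambda>x. ereal (f x)) = \<infinity>"
proof (rule ccontr)
  assume "Limsup F (\<lambda>x. ereal (f x)) \<noteq> \<infinity>"
  then obtain r where "Limsup F (\<lambda>x. ereal (f x)) < ereal r"
    using less_PInf_Ex_of_nat[of "Limsup F (\<lambda>x. ereal (f x))"] by blast
  then have "\<forall>\<^sub>F x in F. ereal (f x) < ereal r"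
    using Limsup_le_iff[of F "\<lambda>x. ereal (f x)" "Limsup F (\<lambda>x. ereal (f x))"] by blast
  then have "\<forall>\<^sub>F x in F. f x < r" by simp
  then show False using assms[of r] by (simp add: frequently_def not_le)
qed

lemma Liminf_ereal_eq_minus_infinity:
  fixes f :: "'a \<Rightarrow> real"
  assumes "\<And>r. \<exists>\<^sub>F x in F. f x \<le> r"
  shows "Liminf F (\<lambda>x. ereal (f x)) = -\<infinity>"
proof -
  have "\<exists>\<^sub>F x in F. r \<le> - f x" for r
    using assms[of "- r"] by (rule frequently_elim1) simp
  then have "Limsup F (\<lambda>x. ereal (- f x)) = \<infinity>" by (rule Limsup_ereal_eq_infinity)
  then show ?thesis using ereal_Liminf_uminus[of F "\<lambda>x. ereal (- f x)"] by simp
qed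

lemma frequently_at_top_exp_odd:
  assumes "\<And>n. even n = b \<Longrightarrow> real n \<ge> r \<Longrightarrow> P (exp (2 * real n + 1))"
  shows "\<exists>\<^sub>F x in at_top. P (x::real)"
  unfolding frequently_def eventually_at_top_linorder
proof
  assume "\<exists>N. \<forall>x\<ge>N. \<not> P x"
  then obtain N where N: "\<And>x. N \<le> x \<Longrightarrow> \<not> P x" by blast
  obtain j :: nat where j: "max r N \<le> real j" using real_arch_simple by blast
  define n where "n = (if b then 2 * j else 2 * j + 1)"
  have "even n = b" "real j \<le> real n" by (auto simp: n_def)
  moreover have "2 * real n + 1 \<le> exp (2 * real n + 1)"
    using exp_ge_add_one_self[of "2 * real n + 1"] by linarith
  ultimately show False using assms[of n] N[of "exp (2 * real n + 1)"] j by auto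
qed

text \<open>Compactness of the \<open>n\<close>-th square yields the amplitude \<open>c n\<close>; only then is the frequency \<open>k n\<close> chosen, large
enough to make the slope reach any prescribed \<open>r n\<close>.\<close>

lemma exists_oscillating_pair:
  assumes A: "tame_density A A'" and B: "tame_density B B'"
  obtains c k where "oscillating_pair A A' B B' c k"
    "\<And>n. r n \<le> c n * (3 * pi * real (k n) / 8)"
proof -
  have "\<exists>c>0. \<forall>s t. 2 * real n \<le> s \<and> s \<le> 2 * real n + 1 \<and> 0 \<le> t \<and> t \<le> 1 \<longrightarrow> c \<le> A s * B t / 2" for n
  proof -
    have "\<exists>s0\<in>{2 * real n..2 * real n + 1}. \<forall>s\<in>{2 * real n..2 * real n + 1}. A s0 \<le> A s"
      by (rule continuous_attains_inf) (auto intro: continuous_on_subset[OF tame_densityD(7)[OF A]])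
    then obtain s0 where s0: "\<And>s. s \<in> {2 * real n..2 * real n + 1} \<Longrightarrow> A s0 \<le> A s" by blast
    have "\<exists>t0\<in>{0..1}. \<forall>t\<in>{0..1}. B t0 \<le> B t"
      by (rule continuous_attains_inf) (auto intro: continuous_on_subset[OF tame_densityD(7)[OF B]])
    then obtain t0 where t0: "\<And>t. t \<in> {0..1} \<Longrightarrow> B t0 \<le> B t" by blast
    have pos: "0 < A s" "0 < B s" for s using tame_densityD(1)[OF A] tame_densityD(1)[OF B] by auto
    show ?thesis
      using pos s0 t0 by (intro exI[of _ "A s0 * B t0 / 2"]) (auto intro!: mult_mono less_imp_le[OF pos(1)] less_imp_le[OF pos(2)])
  qed
  then obtain c where c: "\<And>n. 0 < c n" "\<And>n s t. 2 * real n \<le> s \<Longrightarrow> s \<le> 2 * real n + 1 \<Longrightarrow>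
      0 \<le> t \<Longrightarrow> t \<le> 1 \<Longrightarrow> c n \<le> A s * B t / 2" by metis
  define k where "k n = Suc (nat \<lceil>r n / (c n * (3 * pi / 8))\<rceil>)" for n
  have "oscillating_pair A A' B B' c k"
    by unfold_locales (use A B c in \<open>auto simp: k_def\<close>)
  moreover have "r n \<le> c n * (3 * pi * real (k n) / 8)" for n
  proof -
    have p: "0 < c n * (3 * pi / 8)" using c(1) by simp
    have "r n / (c n * (3 * pi / 8)) \<le> real (k n)" unfolding k_def by linarith
    then show ?thesis using p by (simp add: pos_divide_le_eq mult_ac)
  qed
  ultimately show ?thesis by (rule that)
qed

theorem theorem2p2:
  fixes f1 f2 :: "real \<Rightarrow> real"
  assumes "lin_condition 0 f1" and "lin_condition 0 f2"
  shows "\<exists>(M :: (real \<times> real) measure) (\<xi>1 :: real \<times> real \<Rightarrow> real)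
            (\<xi>2 :: real \<times> real \<Rightarrow> real) (g :: real \<Rightarrow> real).
           prob_space M \<and>
           (\<lambda>\<omega>. (\<xi>1 \<omega>, \<xi>2 \<omega>)) \<in> measurable M borel \<and>
           absolutely_continuous lborel (distr M borel (\<lambda>\<omega>. (\<xi>1 \<omega>, \<xi>2 \<omega>))) \<and>
           distributed M lborel \<xi>1 (\<lambda>x. ennreal (f1 x)) \<and>
           distributed M lborel \<xi>2 (\<lambda>x. ennreal (f2 x)) \<and>
           distributed M lborel (\<lambda>\<omega>. \<xi>1 \<omega> * \<xi>2 \<omega>) (\<lambda>x. ennreal (g x)) \<and>
           regular_density g \<and>
           Limsup at_top (\<lambda>x. ereal (lin_function g x)) = \<infinity> \<and>
           Liminf at_top (\<lambda>x. ereal (lin_function g x)) = - \<infinity>"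
proof -
  define A where "A s = exp s * f1 (exp s)" for s
  define A' where "A' s = exp s * f1 (exp s) + exp s * (exp s * deriv f1 (exp s))" for s
  define B where "B s = exp s * f2 (exp s)" for s
  define B' where "B' s = exp s * f2 (exp s) + exp s * (exp s * deriv f2 (exp s))" for s
  have tame: "tame_density A A'" "tame_density B B'"
    using tame_log_density[OF assms(1)] tame_log_density[OF assms(2)]
    unfolding A_def[abs_def] A'_def[abs_def] B_def[abs_def] B'_def[abs_def] .
  \<comment> \<open>The slope that block \<open>n\<close> must produce at \<open>2n + 1\<close> for the logarithmic derivative of the density of the
      sum to reach \<open>n\<close> in absolute value with the sign of the block.\<close>
  define r where "r n = \<bar>\<integral>s. A' s * B (2 * real n + 1 - s) \<partial>lborel\<bar>
      + real n * (\<integral>s. A s * B (2 * real n + 1 - s) \<partial>lborel)" for n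
  obtain c k where osc: "oscillating_pair A A' B B' c k"
    and r: "\<And>n. r n \<le> c n * (3 * pi * real (k n) / 8)"
    using exists_oscillating_pair[OF tame] by metis
  interpret oscillating_pair A A' B B' c k by fact
  define M where "M = density (lborel \<Otimes>\<^sub>M lborel) (\<lambda>(s, t). ennreal (joint s t))"
  note marg = distributed_marginals[OF joint_measurable less_imp_le[OF joint_pos] joint_fst tame_densityD(4)[OF A] joint_snd,
      folded M_def]
  interpret prob_space M by (rule marg)
  have setsM: "sets M = sets borel" unfolding M_def by (simp add: lborel_prod)
  have acM: "absolutely_continuous lborel M"
    unfolding M_def lborel_prod
    by (intro absolutely_continuousI_density) (simp add: lborel_prod[symmetric])
  have sum_density_nn: "(\<integral>\<^sup>+s. ennreal (joint s (w - s)) \<partial>lborel) = ennreal (sum_density w)" for w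
    using joint_antidiagonal[of w] joint_pos
    by (subst nn_integral_eq_integral) (auto simp: has_bochner_integral_iff intro: less_imp_le)
  have sum: "distributed M lborel (\<lambda>\<omega>. fst \<omega> + snd \<omega>) (\<lambda>w. ennreal (sum_density w))"
    using distributed_add[of "\<lambda>s t. ennreal (joint s t)"] unfolding M_def sum_density_nn by simp
  have sum_density_int: "integrable lborel sum_density"
  proof (rule integrableI_nonneg)
    show "sum_density \<in> borel_measurable lborel"
      by (auto intro!: borel_measurable_continuous_onI continuous_at_imp_continuous_on DERIV_isCont sum_density_deriv)
    show "AE x in lborel. 0 \<le> sum_density x" using sum_density_pos by (auto intro: less_imp_le)
    have "prob_space (density lborel (\<lambda>w. ennreal (sum_density w)))"
      using prob_space_distr[OF distributed_measurable[OF sum]] distributed_distr_eq_density[OF sum] by simp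
    from prob_space.emeasure_space_1[OF this] show "(\<integral>\<^sup>+x. ennreal (sum_density x) \<partial>lborel) < \<infinity>"
      using distributed_borel_measurable[OF sum] by (simp add: emeasure_density)
  qed
  note g = exp_density_regular[OF prob_space_axioms sum sum_density_int sum_density_pos sum_density_deriv continuous_deriv_conv]
  have lin_even: "lin_function (exp_density sum_density) (exp (2 * real n + 1)) \<le> 1 - real n" if "even n" for n
  proof -
    \<comment> \<open>The absolute value in \<open>r n\<close> absorbs the slope in the independent case, which may have either sign.\<close>
    have "real n * sum_density (2 * real n + 1) \<le> deriv sum_density (2 * real n + 1)"
      using r[of n] that unfolding sum_density_peak r_def indep_density_def indep_density'_def by simp
    then show ?thesis using sum_density_pos[of "2 * real n + 1"] by (simp add: g(3) field_simps)
  qed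
  have lin_odd: "1 + real n \<le> lin_function (exp_density sum_density) (exp (2 * real n + 1))" if "odd n" for n
  proof -
    have "deriv sum_density (2 * real n + 1) \<le> - (real n * sum_density (2 * real n + 1))"
      using r[of n] that unfolding sum_density_peak r_def indep_density_def indep_density'_def by simp
    then show ?thesis using sum_density_pos[of "2 * real n + 1"] by (simp add: g(3) field_simps)
  qed
  have limsup: "Limsup at_top (\<lambda>x. ereal (lin_function (exp_density sum_density) x)) = \<infinity>"
  proof (rule Limsup_ereal_eq_infinity)
    fix \<rho> show "\<exists>\<^sub>F x in at_top. \<rho> \<le> lin_function (exp_density sum_density) x"
      by (rule frequently_at_top_exp_odd[where b = False and r = \<rho>]) (use lin_odd in force)
  qed
  have liminf: "Liminf at_top (\<lambda>x. ereal (lin_function (exp_density sum_density) x)) = -\<infinity>"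
  proof (rule Liminf_ereal_eq_minus_infinity)
    fix \<rho> show "\<exists>\<^sub>F x in at_top. lin_function (exp_density sum_density) x \<le> \<rho>"
      by (rule frequently_at_top_exp_odd[where b = True and r = "1 - \<rho>"]) (use lin_even in force)
  qed
  have pd: "positive_rv_density f1" "positive_rv_density f2"
    using assms unfolding lin_condition_def regular_density_def by auto
  have d1: "distributed M lborel (\<lambda>\<omega>. exp (fst \<omega>)) (\<lambda>x. ennreal (f1 x))"
    using pd(1) positive_rv_density_AE[OF pd(1)] unfolding positive_rv_density_def
    by (intro distributed_exp[OF marg(2) tame_densityD(5)[OF A] A_def]) auto
  have d2: "distributed M lborel (\<lambda>\<omega>. exp (snd \<omega>)) (\<lambda>x. ennreal (f2 x))"
    using pd(2) positive_rv_density_AE[OF pd(2)] unfolding positive_rv_density_def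
    by (intro distributed_exp[OF marg(3) tame_densityD(5)[OF B] B_def]) auto
  have meas: "(\<lambda>\<omega>. (exp (fst \<omega>), exp (snd \<omega>))) \<in> measurable M borel"
    unfolding measurable_cong_sets[OF setsM refl]
    by (intro borel_measurable_continuous_onI continuous_intros)
  show ?thesis
  proof (intro exI conjI)
    show "prob_space M" by unfold_locales
    show "distributed M lborel (\<lambda>\<omega>. exp (fst \<omega>) * exp (snd \<omega>)) (\<lambda>x. ennreal (exp_density sum_density x))"
      using g(1) by (simp add: exp_add)
  qed (fact meas d1 d2 limsup liminf g(2) absolutely_continuous_exp_pair[OF acM setsM])+
qed

end
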